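(* Let $A$ be a Banach algebra with a bounded approximate identity. Then the following hold. (i) The algebra $(A^{**},.)$ is unital if and only if $A^{**}$ has a $W^*LBAI$. (ii) The algebra $(A^{**},\circ)$ is unital if and only if $A^{**}$ has a $W^*RBAI$. (iii) $(A^{**},.)$ and $(A^{**},\circ)$ are both unital if and only if $A^{**}$ has a $W^*BAI$. (iv) Suppose that $A$ is weakly sequentially complete and has a sequential bounded approximate identity. Then $A^{**}$ has a $W^*LBAI$ if and only if $A^{**}$ has a $W^*RBAI$; and also $(A^{**},.)$ is unital if and only if $(A^{**},\circ)$ is unital.
   Context: $A$ is regarded as a subspace of $A^{**}$. A bounded approximate identity (BAI) is a bounded net $(e_\alpha)$ in $A$ with $ae_\alpha\to a$ and $e_\alpha a\to a$ in norm for each $a\in A$; it is sequential if the net is a sequence. For $a,b\in A$, $f\in A^*$, $F,G\in A^{**}$, the first Arens product on $A^{**}$ is defined by $\langle f.a,b\rangle=\langle f,ab\rangle$, $\langle F.f,a\rangle=\langle F,f.a\rangle$, $\langle F.G,f\rangle=\langle F,G.f\rangle$; the second by $\langle a\circ f,b\rangle=\langle f,ba\rangle$, $\langle f\circ F,a\rangle=\langle F,a\circ f\rangle$, $\langle F\circ G,f\rangle=\langle G,f\circ F\rangle$. Unital means having a two-sided unit element for the indicated product. One has $a.F=a\circ F$, $F.a=F\circ a$ for $a\in A$. $A^{**}$ has a $W^*LBAI$ if there is a bounded net $(u_\alpha)$ in $A$ with $\langle u_\alpha.F,f\rangle\to\langle F,f\rangle$ for all $F\in A^{**}$, $f\in A^*$;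 it has a $W^*RBAI$ if there is a bounded net $(u_\alpha)$ in $A$ with $\langle F.u_\alpha,f\rangle\to\langle F,f\rangle$ for all $F\in A^{**}$, $f\in A^*$; it has a $W^*BAI$ if it has both a $W^*LBAI$ and a $W^*RBAI$. $A$ is weakly sequentially complete if every weakly Cauchy sequence in $A$ has a weak limit. *)

theory Defs
  imports "HOL-Analysis.Analysis"
begin

text \<open>
  The sort \<open>{real_normed_field, euclidean_space}\<close> has \<open>real\<close> and \<open>complex\<close> as instances, and up to
  isometric isomorphism no others (a commutative real division algebra with multiplicative norm is
  the reals or the complex numbers). Statements for all \<open>'k\<close> of this sort therefore cover exactly
  real and complex Banach algebras. \<open>real_normed_algebra\<close> does not assume a unit.
\<close>

locale banach_algebra_over = vector_space smul
  for smul :: "'k::{real_normed_field, euclidean_space} \<Rightarrow> 'a::{real_normed_algebra, banach} \<Rightarrow> 'a" +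
  assumes smul_of_real: "smul (of_real r) x = r *\<^sub>R x"
    and norm_smul: "norm (smul c x) = norm c * norm x"
    and mult_smul_left: "smul c x * y = smul c (x * y)"
    and mult_smul_right: "x * smul c y = smul c (x * y)"

lemma banach_algebra_over_scaleR:
  "banach_algebra_over (scaleR :: real \<Rightarrow> 'a::{real_normed_algebra, banach} \<Rightarrow> 'a)"
  by unfold_locales (simp_all add: algebra_simps)

lemma banach_algebra_over_complex: "banach_algebra_over ((*) :: complex \<Rightarrow> complex \<Rightarrow> complex)"
  by unfold_locales (simp_all add: algebra_simps norm_mult scaleR_conv_of_real)


definition dual ::
  "('k::{real_normed_field, euclidean_space} \<Rightarrow> 'a::{real_normed_algebra, banach} \<Rightarrow> 'a) \<Rightarrow> ('a \<Rightarrow> 'k) set"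
  where "dual smul = {f. bounded_linear f \<and> (\<forall>c x. f (smul c x) = c * f x)}"

text \<open>
  The norm of a functional \<open>f\<close> in the dual is \<open>onorm f\<close>. Elements of the bidual are functions on the
  carrier set \<open>dual smul\<close>; they are extensional (\<open>undefined\<close> off the carrier), so that equality of
  HOL functions is equality of functionals.
\<close>

definition bidual ::
  "('k::{real_normed_field, euclidean_space} \<Rightarrow> 'a::{real_normed_algebra, banach} \<Rightarrow> 'a)
    \<Rightarrow> (('a \<Rightarrow> 'k) \<Rightarrow> 'k) set"
  where "bidual smul = {F \<in> extensional (dual smul).
    (\<forall>f\<in>dual smul. \<forall>g\<in>dual smul. F (\<lambda>x. f x + g x) = F f + F g) \<and>
    (\<forall>c. \<forall>f\<in>dual smul. F (\<lambda>x. c * f x) = c * F f) \<and>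
    (\<exists>K. \<forall>f\<in>dual smul. norm (F f) \<le> K * onorm f)}"

definition canonical_embedding ::
  "('k::{real_normed_field, euclidean_space} \<Rightarrow> 'a::{real_normed_algebra, banach} \<Rightarrow> 'a)
    \<Rightarrow> 'a \<Rightarrow> (('a \<Rightarrow> 'k) \<Rightarrow> 'k)"
  where "canonical_embedding smul a = (\<lambda>f\<in>dual smul. f a)"


text \<open>First Arens product: \<open>f.a\<close>, \<open>F.f\<close>, \<open>F.G\<close>.\<close>

definition dual_act1 :: "('a::times \<Rightarrow> 'k) \<Rightarrow> 'a \<Rightarrow> ('a \<Rightarrow> 'k)"
  where "dual_act1 f a = (\<lambda>b. f (a * b))"

definition bidual_act1 :: "(('a::times \<Rightarrow> 'k) \<Rightarrow> 'k) \<Rightarrow> ('a \<Rightarrow> 'k) \<Rightarrow> ('a \<Rightarrow> 'k)"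
  where "bidual_act1 F f = (\<lambda>a. F (dual_act1 f a))"

definition arens1 ::
  "('k::{real_normed_field, euclidean_space} \<Rightarrow> 'a::{real_normed_algebra, banach} \<Rightarrow> 'a)
    \<Rightarrow> (('a \<Rightarrow> 'k) \<Rightarrow> 'k) \<Rightarrow> (('a \<Rightarrow> 'k) \<Rightarrow> 'k) \<Rightarrow> (('a \<Rightarrow> 'k) \<Rightarrow> 'k)"
  where "arens1 smul F G = (\<lambda>f\<in>dual smul. F (bidual_act1 G f))"

text \<open>Second Arens product: \<open>a \<circ> f\<close>, \<open>f \<circ> F\<close>, \<open>F \<circ> G\<close>.\<close>

definition dual_act2 :: "'a::times \<Rightarrow> ('a \<Rightarrow> 'k) \<Rightarrow> ('a \<Rightarrow> 'k)"
  where "dual_act2 a f = (\<lambda>b. f (b * a))"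

definition bidual_act2 :: "('a::times \<Rightarrow> 'k) \<Rightarrow> (('a \<Rightarrow> 'k) \<Rightarrow> 'k) \<Rightarrow> ('a \<Rightarrow> 'k)"
  where "bidual_act2 f F = (\<lambda>a. F (dual_act2 a f))"

definition arens2 ::
  "('k::{real_normed_field, euclidean_space} \<Rightarrow> 'a::{real_normed_algebra, banach} \<Rightarrow> 'a)
    \<Rightarrow> (('a \<Rightarrow> 'k) \<Rightarrow> 'k) \<Rightarrow> (('a \<Rightarrow> 'k) \<Rightarrow> 'k) \<Rightarrow> (('a \<Rightarrow> 'k) \<Rightarrow> 'k)"
  where "arens2 smul F G = (\<lambda>f\<in>dual smul. G (bidual_act2 f F))"

definition unital_on :: "'b set \<Rightarrow> ('b \<Rightarrow> 'b \<Rightarrow> 'b) \<Rightarrow> bool"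
  where "unital_on S m \<longleftrightarrow> (\<exists>e\<in>S. \<forall>x\<in>S. m e x = x \<and> m x e = x)"


text \<open>
  A net is a family \<open>u\<close> on a directed set \<open>(I, le)\<close>; it converges if it converges along the filter
  generated by the tails.
\<close>

definition directed_set :: "'i set \<Rightarrow> ('i \<Rightarrow> 'i \<Rightarrow> bool) \<Rightarrow> bool"
  where "directed_set I le \<longleftrightarrow> I \<noteq> {} \<and> (\<forall>i\<in>I. le i i) \<and>
    (\<forall>i\<in>I. \<forall>j\<in>I. \<forall>k\<in>I. le i j \<longrightarrow> le j k \<longrightarrow> le i k) \<and>
    (\<forall>i\<in>I. \<forall>j\<in>I. \<exists>k\<in>I. le i k \<and> le j k)"

definition net_filter :: "'i set \<Rightarrow> ('i \<Rightarrow> 'i \<Rightarrow> bool) \<Rightarrow> 'i filter"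
  where "net_filter I le = (INF i\<in>I. principal {j \<in> I. le i j})"

definition bounded_net :: "'i set \<Rightarrow> ('i \<Rightarrow> 'i \<Rightarrow> bool) \<Rightarrow> ('i \<Rightarrow> 'a::metric_space) \<Rightarrow> bool"
  where "bounded_net I le u \<longleftrightarrow> directed_set I le \<and> bounded (u ` I)"

definition is_bai ::
  "'i set \<Rightarrow> ('i \<Rightarrow> 'i \<Rightarrow> bool) \<Rightarrow> ('i \<Rightarrow> 'a::real_normed_algebra) \<Rightarrow> bool"
  where "is_bai I le u \<longleftrightarrow> bounded_net I le u \<and>
    (\<forall>a. ((\<lambda>i. a * u i) \<longlongrightarrow> a) (net_filter I le) \<and> ((\<lambda>i. u i * a) \<longlongrightarrow> a) (net_filter I le))"

definition is_wstar_lbai ::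
  "('k::{real_normed_field, euclidean_space} \<Rightarrow> 'a::{real_normed_algebra, banach} \<Rightarrow> 'a)
    \<Rightarrow> 'i set \<Rightarrow> ('i \<Rightarrow> 'i \<Rightarrow> bool) \<Rightarrow> ('i \<Rightarrow> 'a) \<Rightarrow> bool"
  where "is_wstar_lbai smul I le u \<longleftrightarrow> bounded_net I le u \<and>
    (\<forall>F\<in>bidual smul. \<forall>f\<in>dual smul.
      ((\<lambda>i. arens1 smul (canonical_embedding smul (u i)) F f) \<longlongrightarrow> F f) (net_filter I le))"

definition is_wstar_rbai ::
  "('k::{real_normed_field, euclidean_space} \<Rightarrow> 'a::{real_normed_algebra, banach} \<Rightarrow> 'a)
    \<Rightarrow> 'i set \<Rightarrow> ('i \<Rightarrow> 'i \<Rightarrow> bool) \<Rightarrow> ('i \<Rightarrow> 'a) \<Rightarrow> bool"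
  where "is_wstar_rbai smul I le u \<longleftrightarrow> bounded_net I le u \<and>
    (\<forall>F\<in>bidual smul. \<forall>f\<in>dual smul.
      ((\<lambda>i. arens1 smul F (canonical_embedding smul (u i)) f) \<longlongrightarrow> F f) (net_filter I le))"

text \<open>
  HOL cannot quantify over the type of the index set inside a formula, so the existential definitions
  fix the index type \<open>'a \<times> 'a set\<close>. This is no restriction: by the lemmas \<open>is_bai_imp_has_bai\<close>,
  \<open>is_wstar_lbai_imp_has_wstar_lbai\<close> and \<open>is_wstar_rbai_imp_has_wstar_rbai\<close> below, such a net
  indexed by any type yields one with this index type.
\<close>

definition has_bai :: "'a::real_normed_algebra itself \<Rightarrow> bool"
  where "has_bai (_ :: 'a itself) \<longleftrightarrow>
    (\<exists>(I :: ('a \<times> 'a set) set) le (u :: 'a \<times> 'a set \<Rightarrow> 'a). is_bai I le u)"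

definition has_sequential_bai :: "'a::real_normed_algebra itself \<Rightarrow> bool"
  where "has_sequential_bai (_ :: 'a itself) \<longleftrightarrow> (\<exists>e :: nat \<Rightarrow> 'a. is_bai UNIV (\<le>) e)"

definition has_wstar_lbai ::
  "('k::{real_normed_field, euclidean_space} \<Rightarrow> 'a::{real_normed_algebra, banach} \<Rightarrow> 'a) \<Rightarrow> bool"
  where "has_wstar_lbai smul \<longleftrightarrow>
    (\<exists>(I :: ('a \<times> 'a set) set) le u. is_wstar_lbai smul I le u)"

definition has_wstar_rbai ::
  "('k::{real_normed_field, euclidean_space} \<Rightarrow> 'a::{real_normed_algebra, banach} \<Rightarrow> 'a) \<Rightarrow> bool"
  where "has_wstar_rbai smul \<longleftrightarrow>
    (\<exists>(I :: ('a \<times> 'a set) set) le u. is_wstar_rbai smul I le u)"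

definition has_wstar_bai ::
  "('k::{real_normed_field, euclidean_space} \<Rightarrow> 'a::{real_normed_algebra, banach} \<Rightarrow> 'a) \<Rightarrow> bool"
  where "has_wstar_bai smul \<longleftrightarrow> has_wstar_lbai smul \<and> has_wstar_rbai smul"

definition weakly_Cauchy ::
  "('k::{real_normed_field, euclidean_space} \<Rightarrow> 'a::{real_normed_algebra, banach} \<Rightarrow> 'a)
    \<Rightarrow> (nat \<Rightarrow> 'a) \<Rightarrow> bool"
  where "weakly_Cauchy smul x \<longleftrightarrow> (\<forall>f\<in>dual smul. Cauchy (\<lambda>n. f (x n)))"

definition weakly_sequentially_complete ::
  "('k::{real_normed_field, euclidean_space} \<Rightarrow> 'a::{real_normed_algebra, banach} \<Rightarrow> 'a) \<Rightarrow> bool"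
  where "weakly_sequentially_complete smul \<longleftrightarrow>
    (\<forall>x. weakly_Cauchy smul x \<longrightarrow> (\<exists>l. \<forall>f\<in>dual smul. (\<lambda>n. f (x n)) \<longlonglongrightarrow> f l))"


lemma eventually_net_filter:
  assumes "directed_set I le"
  shows "eventually P (net_filter I le) \<longleftrightarrow> (\<exists>i\<in>I. \<forall>j\<in>I. le i j \<longrightarrow> P j)"
proof -
  have "eventually P (net_filter I le) \<longleftrightarrow> (\<exists>i\<in>I. eventually P (principal {j \<in> I. le i j}))"
    unfolding net_filter_def
  proof (rule eventually_INF_base)
    show "I \<noteq> {}"
      using assms by (simp add: directed_set_def)
  next
    fix i j assume ij: "i \<in> I" "j \<in> I"
    then obtain k where k: "k \<in> I" "le i k" "le j k"
      using assms unfolding directed_set_def by meson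
    have "le i l \<and> le j l" if "l \<in> I" "le k l" for l
      using assms ij k that unfolding directed_set_def by meson
    then show "\<exists>x\<in>I. principal {l \<in> I. le x l}
        \<le> inf (principal {j \<in> I. le i j}) (principal {l \<in> I. le j l})"
      using k(1) by auto
  qed
  then show ?thesis
    by (auto simp: eventually_principal)
qed

lemma net_filter_nat: "net_filter UNIV (\<le>) = (sequentially :: nat filter)"
proof -
  have "directed_set UNIV ((\<le>) :: nat \<Rightarrow> nat \<Rightarrow> bool)"
    by (auto simp: directed_set_def intro: max.cobounded1 max.cobounded2)
  then show ?thesis
    by (simp add: filter_eq_iff eventually_net_filter eventually_sequentially)
qed

lemma canonical_net:
  fixes u :: "'i \<Rightarrow> 'a::metric_space"
  assumes "bounded_net I le u"
  obtains I' :: "('a \<times> 'a set) set" and le' and u' :: "'a \<times> 'a set \<Rightarrow> 'a"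
  where "bounded_net I' le' u'"
    and "\<And>g :: 'a \<Rightarrow> 'b::topological_space. \<And>l. ((\<lambda>i. g (u i)) \<longlongrightarrow> l) (net_filter I le)
      \<Longrightarrow> ((\<lambda>i. g (u' i)) \<longlongrightarrow> l) (net_filter I' le')"
proof -
  define \<Phi> where "\<Phi> = net_filter I le"
  define I' where "I' = {(x, S). x \<in> S \<and> S \<subseteq> u ` I \<and> eventually (\<lambda>i. u i \<in> S) \<Phi>}"
  define le' where "le' = (\<lambda>(p :: 'a \<times> 'a set) (q :: 'a \<times> 'a set). snd q \<subseteq> snd p)"
  have dir: "directed_set I le" and bdd: "bounded (u ` I)"
    using assms by (auto simp: bounded_net_def)
  have "I \<noteq> {}" and refl: "\<And>i. i \<in> I \<Longrightarrow> le i i"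
    using dir by (simp_all add: directed_set_def)
  have nonbot: "\<not> eventually (\<lambda>_. False) \<Phi>"
    using refl unfolding \<Phi>_def eventually_net_filter[OF dir] by blast
  have ev_I: "eventually (\<lambda>i. u i \<in> u ` I) \<Phi>"
    using \<open>I \<noteq> {}\<close> unfolding \<Phi>_def eventually_net_filter[OF dir] by auto
  have ex: "\<exists>x. (x, S \<inter> u ` I) \<in> I'" if "eventually (\<lambda>i. u i \<in> S) \<Phi>" for S
  proof -
    have ev: "eventually (\<lambda>i. u i \<in> S \<inter> u ` I) \<Phi>"
      using eventually_conj[OF that ev_I] by simp
    have "S \<inter> u ` I \<noteq> {}"
    proof
      assume "S \<inter> u ` I = {}"
      with ev nonbot show False
        by (simp only: empty_iff)
    qed
    then obtain x where "x \<in> S \<inter> u ` I"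
      by blast
    then have "(x, S \<inter> u ` I) \<in> I'"
      using ev unfolding I'_def by blast
    then show ?thesis ..
  qed
  have dir': "directed_set I' le'"
    unfolding directed_set_def
  proof (intro conjI ballI impI)
    show "I' \<noteq> {}"
      using ex[of UNIV] by auto
  next
    fix p q assume "p \<in> I'" "q \<in> I'"
    then have "eventually (\<lambda>i. u i \<in> snd p) \<Phi>" "eventually (\<lambda>i. u i \<in> snd q) \<Phi>"
      by (simp_all add: I'_def case_prod_beta)
    then have "eventually (\<lambda>i. u i \<in> snd p \<inter> snd q) \<Phi>"
      by (simp add: eventually_conj_iff)
    from ex[OF this] obtain x where "(x, snd p \<inter> snd q \<inter> u ` I) \<in> I'" ..
    then show "\<exists>r\<in>I'. le' p r \<and> le' q r"
      by (rule bexI[rotated]) (auto simp: le'_def)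
  qed (auto simp: le'_def)
  have "fst ` I' \<subseteq> u ` I"
    by (auto simp: I'_def)
  then have bdd': "bounded_net I' le' fst"
    using dir' bdd bounded_subset by (auto simp: bounded_net_def)
  have "((\<lambda>i. g (fst i)) \<longlongrightarrow> l) (net_filter I' le')"
    if lim: "((\<lambda>i. g (u i)) \<longlongrightarrow> l) (net_filter I le)" for g :: "'a \<Rightarrow> 'b" and l
  proof (rule topological_tendstoI)
    fix U assume "open U" "l \<in> U"
    then have "eventually (\<lambda>i. u i \<in> {x. g x \<in> U}) \<Phi>"
      using topological_tendstoD[OF lim] by (simp add: \<Phi>_def)
    from ex[OF this] obtain x where x: "(x, {x. g x \<in> U} \<inter> u ` I) \<in> I'" ..
    show "eventually (\<lambda>i. g (fst i) \<in> U) (net_filter I' le')"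
      unfolding eventually_net_filter[OF dir']
      by (rule bexI[OF _ x]) (auto simp: le'_def I'_def)
  qed
  with bdd' show thesis
    by (rule that)
qed

lemma is_bai_imp_has_bai:
  fixes u :: "'i \<Rightarrow> 'a::real_normed_algebra"
  assumes "is_bai I le u"
  shows "has_bai TYPE('a)"
proof -
  have "bounded_net I le u"
    using assms by (simp add: is_bai_def)
  then obtain I' :: "('a \<times> 'a set) set" and le' and u' :: "'a \<times> 'a set \<Rightarrow> 'a"
    where "bounded_net I' le' u'"
      and lim: "\<And>(g :: 'a \<Rightarrow> 'a) l. ((\<lambda>i. g (u i)) \<longlongrightarrow> l) (net_filter I le)
        \<Longrightarrow> ((\<lambda>i. g (u' i)) \<longlongrightarrow> l) (net_filter I' le')"
    by (rule canonical_net) blast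
  moreover have "((\<lambda>i. a * u' i) \<longlongrightarrow> a) (net_filter I' le')"
      "((\<lambda>i. u' i * a) \<longlongrightarrow> a) (net_filter I' le')" for a
    using assms lim[of "\<lambda>x. a * x"] lim[of "\<lambda>x. x * a"] by (simp_all add: is_bai_def)
  ultimately have "is_bai I' le' u'"
    by (simp add: is_bai_def)
  then show ?thesis
    by (auto simp: has_bai_def)
qed

lemma is_wstar_lbai_imp_has_wstar_lbai:
  fixes smul :: "'k::{real_normed_field, euclidean_space} \<Rightarrow> 'a::{real_normed_algebra, banach} \<Rightarrow> 'a"
    and u :: "'i \<Rightarrow> 'a"
  assumes "is_wstar_lbai smul I le u"
  shows "has_wstar_lbai smul"
proof -
  have "bounded_net I le u"
    using assms by (simp add: is_wstar_lbai_def)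
  then obtain I' :: "('a \<times> 'a set) set" and le' and u' :: "'a \<times> 'a set \<Rightarrow> 'a"
    where "bounded_net I' le' u'"
      and lim: "\<And>(g :: 'a \<Rightarrow> 'k) l. ((\<lambda>i. g (u i)) \<longlongrightarrow> l) (net_filter I le)
        \<Longrightarrow> ((\<lambda>i. g (u' i)) \<longlongrightarrow> l) (net_filter I' le')"
    by (rule canonical_net) blast
  then have "is_wstar_lbai smul I' le' u'"
    using assms lim[of "\<lambda>x. arens1 smul (canonical_embedding smul x) F f" for F f]
    by (simp add: is_wstar_lbai_def)
  then show ?thesis
    by (auto simp: has_wstar_lbai_def)
qed

lemma is_wstar_rbai_imp_has_wstar_rbai:
  fixes smul :: "'k::{real_normed_field, euclidean_space} \<Rightarrow> 'a::{real_normed_algebra, banach} \<Rightarrow> 'a"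
    and u :: "'i \<Rightarrow> 'a"
  assumes "is_wstar_rbai smul I le u"
  shows "has_wstar_rbai smul"
proof -
  have "bounded_net I le u"
    using assms by (simp add: is_wstar_rbai_def)
  then obtain I' :: "('a \<times> 'a set) set" and le' and u' :: "'a \<times> 'a set \<Rightarrow> 'a"
    where "bounded_net I' le' u'"
      and lim: "\<And>(g :: 'a \<Rightarrow> 'k) l. ((\<lambda>i. g (u i)) \<longlongrightarrow> l) (net_filter I le)
        \<Longrightarrow> ((\<lambda>i. g (u' i)) \<longlongrightarrow> l) (net_filter I' le')"
    by (rule canonical_net) blast
  then have "is_wstar_rbai smul I' le' u'"
    using assms lim[of "\<lambda>x. arens1 smul F (canonical_embedding smul x) f" for F f]
    by (simp add: is_wstar_rbai_def)
  then show ?thesis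
    by (auto simp: has_wstar_rbai_def)
qed

end

theory Submission
  imports Defs
begin

text \<open>
  By Banach--Alaoglu every bounded net in \<open>A\<close> has weak-* cluster points in \<open>A**\<close>. Those of a bounded
  approximate identity are right units for the first Arens product, and those of a \<open>W*LBAI\<close> are
  left units. Conversely, if \<open>E\<close> is a two-sided unit, then any right unit equals \<open>E\<close>; so \<open>E\<close> is the
  only cluster point of a bounded approximate identity, which therefore converges weak-* to \<open>E\<close> and
  is itself a \<open>W*LBAI\<close>. The second product is the first product of the opposite algebra, up to the
  order of its arguments. If \<open>A\<close> is weakly sequentially complete and the bounded approximate identity
  is a sequence, then \<open>E\<close> is the image of a point of \<open>A\<close>, which functionals cannot distinguish from
  a two-sided unit of \<open>A\<close>; this condition is symmetric in the two products.
\<close>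

section \<open>Compactness and nets\<close>

text \<open>\<open>G\<close> plays the role of a convergent subnet: it refines \<open>\<Phi>\<close>
  by the preimages of the neighbourhoods of a cluster point \<open>x\<close>. It is proper, since
  otherwise \<open>X\<close> would eventually avoid some neighbourhood of \<open>x\<close>.\<close>

lemma tendsto_cluster_filter:
  fixes X :: "'i \<Rightarrow> 'b::topological_space"
  assumes "compact K" "\<Phi> \<noteq> bot" "eventually (\<lambda>i. X i \<in> K) \<Phi>"
  obtains x G where "x \<in> K" "G \<le> \<Phi>" "G \<noteq> bot" "(X \<longlongrightarrow> x) G"
proof -
  have "filtermap X \<Phi> \<noteq> bot" "eventually (\<lambda>x. x \<in> K) (filtermap X \<Phi>)"
    using assms by (simp_all add: filtermap_bot_iff eventually_filtermap)
  with \<open>compact K\<close> obtain x where x: "x \<in> K" "inf (nhds x) (filtermap X \<Phi>) \<noteq> bot"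
    unfolding compact_filter by blast
  define G where "G = inf (filtercomap X (nhds x)) \<Phi>"
  have "G \<noteq> bot"
  proof
    assume "G = bot"
    then obtain P Q where P: "eventually P (nhds x)" and Q: "eventually Q \<Phi>"
      and PQ: "\<And>i. P (X i) \<Longrightarrow> Q i \<Longrightarrow> False"
      unfolding G_def trivial_limit_def eventually_inf eventually_filtercomap by blast
    from Q have "eventually (\<lambda>i. \<not> P (X i)) \<Phi>"
      by (rule eventually_mono) (use PQ in blast)
    then have "eventually (\<lambda>y. \<not> P y) (filtermap X \<Phi>)"
      by (simp add: eventually_filtermap)
    with P have "eventually (\<lambda>_. False) (inf (nhds x) (filtermap X \<Phi>))"
      unfolding eventually_inf by blast
    with x(2) show False
      by (simp add: trivial_limit_def)
  qed
  moreover have "(X \<longlongrightarrow> x) G"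
    unfolding G_def by (rule filterlim_mono[OF filterlim_filtercomap order_refl]) simp
  moreover have "G \<le> \<Phi>"
    by (simp add: G_def)
  ultimately show thesis
    using that x(1) by blast
qed

text \<open>Tychonoff's theorem, carried over to the topology of the function type.\<close>

lemma compact_Pi_UNIV:
  fixes S :: "'i \<Rightarrow> 'b::topological_space set"
  assumes "\<And>i. compact (S i)"
  shows "compact (Pi UNIV S)"
proof -
  have "compactin (product_topology (\<lambda>_. euclidean) UNIV) (PiE UNIV S)"
    using assms by (simp add: compactin_PiE)
  then show ?thesis
    by (simp add: euclidean_product_topology PiE_UNIV_domain)
qed

lemma net_filter_neq_bot:
  assumes "directed_set I le"
  shows "net_filter I le \<noteq> bot"
  using assms unfolding trivial_limit_def eventually_net_filter[OF assms] directed_set_def by blast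

lemma bounded_net_eventually_le:
  fixes u :: "'i \<Rightarrow> 'a::real_normed_vector"
  assumes "bounded_net I le u"
  obtains B where "eventually (\<lambda>i. norm (u i) \<le> B) (net_filter I le)"
proof -
  have dir: "directed_set I le"
    using assms by (simp add: bounded_net_def)
  obtain B where "\<forall>i\<in>I. norm (u i) \<le> B"
    using assms unfolding bounded_net_def bounded_iff by blast
  then have "eventually (\<lambda>i. norm (u i) \<le> B) (net_filter I le)"
    using dir unfolding eventually_net_filter[OF dir] directed_set_def by blast
  then show thesis
    by (rule that)
qed

lemma unital_on_flip: "unital_on S (\<lambda>x y. m y x) \<longleftrightarrow> unital_on S m"
  unfolding unital_on_def by blast

section \<open>Functionals and weak-* cluster points in the bidual\<close>

context banach_algebra_over
begin

text \<open>Real homogeneity, which \<open>bounded_linear\<close> asks for, is the case of scalars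
  \<open>of_real r\<close>.\<close>

lemma dualI:
  assumes "\<And>x y. f (x + y) = f x + f y" "\<And>c x. f (smul c x) = c * f x"
    and "\<And>x. norm (f x) \<le> K * norm x"
  shows "f \<in> dual smul"
proof -
  have "f (r *\<^sub>R x) = r *\<^sub>R f x" for r x
    using assms(2)[of "of_real r" x] by (simp add: smul_of_real scaleR_conv_of_real)
  then have "bounded_linear f"
    using assms(1,3) by (intro bounded_linear_intro[where K = K]) (simp_all add: mult.commute)
  with assms(2) show ?thesis
    by (simp add: dual_def)
qed

lemma bidual_nonneg_bound:
  assumes "F \<in> bidual smul"
  obtains K where "K \<ge> 0" "\<And>f. f \<in> dual smul \<Longrightarrow> norm (F f) \<le> K * onorm f"
proof -
  obtain K where K: "\<forall>f\<in>dual smul. norm (F f) \<le> K * onorm f"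
    using assms unfolding bidual_def by blast
  have "norm (F f) \<le> \<bar>K\<bar> * onorm f" if "f \<in> dual smul" for f
  proof -
    have "onorm f \<ge> 0"
      using that by (simp add: dual_def onorm_pos_le)
    then have "K * onorm f \<le> \<bar>K\<bar> * onorm f"
      by (intro mult_right_mono) auto
    with K that show ?thesis
      by fastforce
  qed
  then show thesis
    using that[of "\<bar>K\<bar>"] by simp
qed

text \<open>Banach-Alaoglu in filter form: the evaluations at \<open>u i\<close> eventually lie in a
  product of closed balls of scalars, which is compact. Linearity and the bound
  \<open>B * onorm f\<close> pass to the limit pointwise.\<close>

lemma bidual_cluster_point:
  fixes u :: "'i \<Rightarrow> 'a"
  assumes "\<Phi> \<noteq> bot" "eventually (\<lambda>i. norm (u i) \<le> B) \<Phi>"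
  obtains E G where "E \<in> bidual smul" "G \<le> \<Phi>" "G \<noteq> bot"
    "\<And>f. f \<in> dual smul \<Longrightarrow> ((\<lambda>i. f (u i)) \<longlongrightarrow> E f) G"
proof -
  \<comment> \<open>The product runs over all functions, so those outside the dual get the value 0;
    the absolute value in \<open>S\<close> keeps 0 in their balls.\<close>
  define X where "X = (\<lambda>i f. if f \<in> dual smul then f (u i) else 0 :: 'k)"
  define S where "S = (\<lambda>f :: 'a \<Rightarrow> 'k. cball (0 :: 'k) \<bar>B * onorm f\<bar>)"
  have bound: "norm (f (u i)) \<le> B * onorm f" if "f \<in> dual smul" "norm (u i) \<le> B" for f i
  proof -
    have f: "bounded_linear f"
      using that by (simp add: dual_def)
    have "norm (f (u i)) \<le> onorm f * norm (u i)"
      by (rule onorm[OF f])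
    also have "\<dots> \<le> onorm f * B"
      using that onorm_pos_le[OF f] by (intro mult_left_mono)
    finally show ?thesis
      by (simp add: mult.commute)
  qed
  have cpt: "compact (Pi UNIV S)"
    by (rule compact_Pi_UNIV) (simp add: S_def)
  have ev: "eventually (\<lambda>i. X i \<in> Pi UNIV S) \<Phi>"
    using assms(2) by (rule eventually_mono) (use bound in \<open>fastforce simp: X_def S_def\<close>)
  obtain Y G where G: "G \<le> \<Phi>" "G \<noteq> bot" and lim: "(X \<longlongrightarrow> Y) G"
    by (rule tendsto_cluster_filter[OF cpt assms(1) ev]) blast
  \<comment> \<open>Elements of \<open>bidual smul\<close> are extensional, so the values of
    \<open>Y\<close> off the dual are discarded.\<close>
  define E where "E = restrict Y (dual smul)"
  have lim_E: "((\<lambda>i. f (u i)) \<longlongrightarrow> E f) G" if "f \<in> dual smul" for f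
  proof -
    have "((\<lambda>i. X i f) \<longlongrightarrow> Y f) G"
      by (rule continuous_on_tendsto_compose[OF continuous_on_product_coordinates lim]) simp_all
    then show ?thesis
      using that by (simp add: X_def E_def)
  qed
  have add: "(\<lambda>x. f x + g x) \<in> dual smul" if "f \<in> dual smul" "g \<in> dual smul" for f g
    using that by (auto simp: dual_def bounded_linear_add algebra_simps)
  have scale: "(\<lambda>x. c * f x) \<in> dual smul" if "f \<in> dual smul" for c f
    using that by (auto simp: dual_def bounded_linear_const_mult)
  have "E \<in> bidual smul"
    unfolding bidual_def
  proof (intro CollectI conjI ballI allI)
    show "E \<in> extensional (dual smul)"
      by (simp add: E_def)
  next
    fix f g assume fg: "f \<in> dual smul" "g \<in> dual smul"
    show "E (\<lambda>x. f x + g x) = E f + E g"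
      using tendsto_unique[OF G(2) lim_E[OF add[OF fg]]] tendsto_add[OF lim_E[OF fg(1)] lim_E[OF fg(2)]]
      by blast
  next
    fix c f assume f: "f \<in> dual smul"
    show "E (\<lambda>x. c * f x) = c * E f"
      using tendsto_unique[OF G(2) lim_E[OF scale[OF f]]] tendsto_mult_left[OF lim_E[OF f]]
      by blast
  next
    have "norm (E f) \<le> B * onorm f" if "f \<in> dual smul" for f
    proof (rule Lim_norm_ubound[OF G(2) lim_E[OF that]])
      show "eventually (\<lambda>i. norm (f (u i)) \<le> B * onorm f) G"
        using filter_leD[OF G(1) assms(2)] by (rule eventually_mono) (use bound that in blast)
    qed
    then show "\<exists>K. \<forall>f\<in>dual smul. norm (E f) \<le> K * onorm f"
      by blast
  qed
  then show thesis
    using G lim_E by (rule that)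
qed

end

section \<open>One Arens product for an algebra and its opposite\<close>

text \<open>
  The product \<open>p\<close> is the multiplication of \<open>A\<close> or of its opposite algebra.
\<close>

locale bilinear_product = banach_algebra_over smul
  for smul :: "'k::{real_normed_field, euclidean_space} \<Rightarrow> 'a::{real_normed_algebra, banach} \<Rightarrow> 'a" +
  fixes p :: "'a \<Rightarrow> 'a \<Rightarrow> 'a"
  assumes bilinear: "bounded_bilinear p"
    and smul_left: "p (smul c x) y = smul c (p x y)"
    and smul_right: "p x (smul c y) = smul c (p x y)"
begin

text \<open>For \<open>p\<close> the multiplication this is \<open>arens1\<close>; for the reversed
  multiplication it is \<open>arens2\<close> with its arguments exchanged.\<close>

definition arens :: "(('a \<Rightarrow> 'k) \<Rightarrow> 'k) \<Rightarrow> (('a \<Rightarrow> 'k) \<Rightarrow> 'k) \<Rightarrow> (('a \<Rightarrow> 'k) \<Rightarrow> 'k)"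
  where "arens F G = (\<lambda>f\<in>dual smul. F (\<lambda>a. G (\<lambda>b. f (p a b))))"

text \<open>The expression under the limit is the product of the embedded \<open>u i\<close> with
  \<open>F\<close>, already evaluated at \<open>f\<close>. The multiplication gives a W*LBAI, the
  reversed one a W*RBAI.\<close>

definition is_wstar_bai :: "'i set \<Rightarrow> ('i \<Rightarrow> 'i \<Rightarrow> bool) \<Rightarrow> ('i \<Rightarrow> 'a) \<Rightarrow> bool"
  where "is_wstar_bai I le u \<longleftrightarrow> bounded_net I le u \<and>
    (\<forall>F\<in>bidual smul. \<forall>f\<in>dual smul.
      ((\<lambda>i. F (\<lambda>b. f (p (u i) b))) \<longlongrightarrow> F f) (net_filter I le))"

definition is_right_bai :: "'i set \<Rightarrow> ('i \<Rightarrow> 'i \<Rightarrow> bool) \<Rightarrow> ('i \<Rightarrow> 'a) \<Rightarrow> bool"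
  where "is_right_bai I le u \<longleftrightarrow> bounded_net I le u \<and>
    (\<forall>a. ((\<lambda>i. p a (u i)) \<longlongrightarrow> a) (net_filter I le))"

lemma dual_compose_left:
  assumes "f \<in> dual smul"
  shows "(\<lambda>b. f (p a b)) \<in> dual smul"
proof -
  have "bounded_linear (\<lambda>b. f (p a b))"
    using assms bounded_bilinear.bounded_linear_right[OF bilinear]
    by (auto simp: dual_def intro: bounded_linear_compose[where f = f])
  with assms show ?thesis
    by (simp add: dual_def smul_right)
qed

lemma dual_compose_right:
  assumes "f \<in> dual smul"
  shows "(\<lambda>a. f (p a b)) \<in> dual smul"
proof -
  have "bounded_linear (\<lambda>a. f (p a b))"
    using assms bounded_bilinear.bounded_linear_left[OF bilinear]
    by (auto simp: dual_def intro: bounded_linear_compose[where f = f])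
  with assms show ?thesis
    by (simp add: dual_def smul_left)
qed

text \<open>This is the functional \<open>F.f\<close>. Its membership in the dual allows weak-*
  limits to be evaluated at it.\<close>

lemma bidual_act_in_dual:
  assumes F: "F \<in> bidual smul" and f: "f \<in> dual smul"
  shows "(\<lambda>a. F (\<lambda>b. f (p a b))) \<in> dual smul"
proof -
  have bl: "bounded_linear f"
    using f by (simp add: dual_def)
  obtain K where K: "K \<ge> 0" "\<And>f. f \<in> dual smul \<Longrightarrow> norm (F f) \<le> K * onorm f"
    using bidual_nonneg_bound[OF F] by blast
  obtain M where M: "M \<ge> 0" "\<And>a b. norm (p a b) \<le> norm a * norm b * M"
    using bounded_bilinear.nonneg_bounded[OF bilinear] by blast
  have bound: "norm (F (\<lambda>b. f (p a b))) \<le> K * onorm f * M * norm a" for a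
  proof -
    have "norm (f (p a b)) \<le> onorm f * M * norm a * norm b" for b
    proof -
      have "norm (f (p a b)) \<le> onorm f * norm (p a b)"
        by (rule onorm[OF bl])
      also have "\<dots> \<le> onorm f * (norm a * norm b * M)"
        by (intro mult_left_mono M onorm_pos_le[OF bl])
      finally show ?thesis
        by (simp add: algebra_simps)
    qed
    then have "onorm (\<lambda>b. f (p a b)) \<le> onorm f * M * norm a"
      using M onorm_pos_le[OF bl] by (intro onorm_bound) auto
    then have "K * onorm (\<lambda>b. f (p a b)) \<le> K * (onorm f * M * norm a)"
      using K(1) by (intro mult_left_mono)
    with K(2)[OF dual_compose_left[OF f], of a] show ?thesis
      by (simp add: mult.assoc)
  qed
  show ?thesis
  proof (rule dualI)
    fix x y
    have "(\<lambda>b. f (p (x + y) b)) = (\<lambda>b. f (p x b) + f (p y b))"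
      using bounded_bilinear.add_left[OF bilinear] linear_add[OF bounded_linear.linear[OF bl]] by simp
    then show "F (\<lambda>b. f (p (x + y) b)) = F (\<lambda>b. f (p x b)) + F (\<lambda>b. f (p y b))"
      using F dual_compose_left[OF f] by (simp add: bidual_def)
  next
    fix c x
    show "F (\<lambda>b. f (p (smul c x) b)) = c * F (\<lambda>b. f (p x b))"
      using F f dual_compose_left[OF f] by (simp add: bidual_def dual_def smul_left)
  qed (rule bound)
qed

section \<open>Units as weak-* limits of nets\<close>

text \<open>The value of \<open>E\<close> at \<open>\<lambda>b. f (p a b)\<close> is the limit of
  \<open>f (p a (e i))\<close>, that is \<open>f a\<close>. Hence \<open>E.f = f\<close>, and
  \<open>F\<close> is applied to \<open>f\<close> itself.\<close>

lemma arens_right_unit: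
  assumes E: "\<And>f. f \<in> dual smul \<Longrightarrow> ((\<lambda>i. f (e i)) \<longlongrightarrow> E f) G"
    and "G \<noteq> bot" and e: "\<And>a. ((\<lambda>i. p a (e i)) \<longlongrightarrow> a) G" and F: "F \<in> bidual smul"
  shows "arens F E = F"
proof
  fix f
  show "arens F E f = F f"
  proof (cases "f \<in> dual smul")
    case True
    have "E (\<lambda>b. f (p a b)) = f a" for a
    proof (rule tendsto_unique[OF \<open>G \<noteq> bot\<close> E[OF dual_compose_left[OF True]]])
      show "((\<lambda>i. f (p a (e i))) \<longlongrightarrow> f a) G"
        using True e bounded_linear.tendsto by (force simp: dual_def)
    qed
    with True show ?thesis
      by (simp add: arens_def)
  next
    case False
    with F show ?thesis
      by (simp add: arens_def bidual_def extensional_def)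
  qed
qed

text \<open>The value of \<open>E\<close> at \<open>F.f\<close> is the limit of \<open>F.f\<close>
  along \<open>u\<close>, which the last hypothesis identifies as \<open>F f\<close>.\<close>

lemma arens_left_unit:
  assumes E: "\<And>f. f \<in> dual smul \<Longrightarrow> ((\<lambda>i. f (u i)) \<longlongrightarrow> E f) G"
    and "G \<noteq> bot" and F: "F \<in> bidual smul"
    and u: "\<And>f. f \<in> dual smul \<Longrightarrow> ((\<lambda>i. F (\<lambda>b. f (p (u i) b))) \<longlongrightarrow> F f) G"
  shows "arens E F = F"
proof
  fix f
  show "arens E F f = F f"
  proof (cases "f \<in> dual smul")
    case True
    then show ?thesis
      using tendsto_unique[OF \<open>G \<noteq> bot\<close> E[OF bidual_act_in_dual[OF F True]] u[OF True]]
      by (simp add: arens_def)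
  next
    case False
    with F show ?thesis
      by (simp add: arens_def bidual_def extensional_def)
  qed
qed

text \<open>A cluster point \<open>R\<close> of \<open>e\<close> is a right unit and a cluster point
  \<open>L\<close> of \<open>u\<close> is a left unit, so \<open>L = L.R = R\<close>.\<close>

lemma wstar_bai_imp_unital:
  fixes e :: "'i \<Rightarrow> 'a" and u :: "'j \<Rightarrow> 'a"
  assumes e: "is_right_bai I le e" and u: "is_wstar_bai J le' u"
  shows "unital_on (bidual smul) arens"
proof -
  have bdd: "bounded_net I le e" "bounded_net J le' u"
    using e u by (simp_all add: is_right_bai_def is_wstar_bai_def)
  then have nonbot: "net_filter I le \<noteq> bot" "net_filter J le' \<noteq> bot"
    by (simp_all add: bounded_net_def net_filter_neq_bot)
  obtain B C where B: "eventually (\<lambda>i. norm (e i) \<le> B) (net_filter I le)"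
    and C: "eventually (\<lambda>i. norm (u i) \<le> C) (net_filter J le')"
    using bdd bounded_net_eventually_le by metis
  obtain R G where R: "R \<in> bidual smul" "G \<le> net_filter I le" "G \<noteq> bot"
    "\<And>f. f \<in> dual smul \<Longrightarrow> ((\<lambda>i. f (e i)) \<longlongrightarrow> R f) G"
    using bidual_cluster_point[OF nonbot(1) B] by blast
  obtain L H where L: "L \<in> bidual smul" "H \<le> net_filter J le'" "H \<noteq> bot"
    "\<And>f. f \<in> dual smul \<Longrightarrow> ((\<lambda>i. f (u i)) \<longlongrightarrow> L f) H"
    using bidual_cluster_point[OF nonbot(2) C] by blast
  have right: "arens F R = F" if "F \<in> bidual smul" for F
    using R(4,3) _ that
  proof (rule arens_right_unit)
    show "((\<lambda>i. p a (e i)) \<longlongrightarrow> a) G" for a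
      using e R(2) by (auto simp: is_right_bai_def intro: tendsto_mono)
  qed
  have left: "arens L F = F" if "F \<in> bidual smul" for F
    using L(4,3) that
  proof (rule arens_left_unit)
    show "((\<lambda>i. F (\<lambda>b. f (p (u i) b))) \<longlongrightarrow> F f) H" if "f \<in> dual smul" for f
      using u L(2) \<open>F \<in> bidual smul\<close> that by (auto simp: is_wstar_bai_def intro: tendsto_mono)
  qed
  have "L = R"
    using right[OF L(1)] left[OF R(1)] by simp
  with L(1) left right show ?thesis
    unfolding unital_on_def by blast
qed

text \<open>Every cluster point \<open>R\<close> of \<open>e\<close> is a right unit, so
  \<open>R = E.R = E\<close>. A bounded net with a single weak-* cluster point converges to
  it.\<close>

lemma right_bai_tendsto_unit:
  fixes e :: "'i \<Rightarrow> 'a"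
  assumes e: "is_right_bai I le e"
    and E: "E \<in> bidual smul" "\<And>F. F \<in> bidual smul \<Longrightarrow> arens E F = F"
    and f: "f \<in> dual smul"
  shows "((\<lambda>i. f (e i)) \<longlongrightarrow> E f) (net_filter I le)"
proof (rule ccontr)
  assume "\<not> ?thesis"
  then obtain U where U: "open U" "E f \<in> U"
    "\<not> eventually (\<lambda>i. f (e i) \<in> U) (net_filter I le)"
    unfolding tendsto_def by blast
  \<comment> \<open>Failure of convergence says exactly that the indices with \<open>f (e i)\<close>
    outside \<open>U\<close> generate a proper filter; a cluster point along it cannot be
    \<open>E\<close>.\<close>
  define \<Phi> where "\<Phi> = inf (net_filter I le) (principal {i. f (e i) \<notin> U})"
  have "\<Phi> \<noteq> bot"
    using U(3) by (simp add: \<Phi>_def trivial_limit_def eventually_inf_principal)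
  obtain B where "eventually (\<lambda>i. norm (e i) \<le> B) (net_filter I le)"
    using e bounded_net_eventually_le unfolding is_right_bai_def by blast
  then have "eventually (\<lambda>i. norm (e i) \<le> B) \<Phi>"
    by (rule filter_leD[rotated]) (simp add: \<Phi>_def)
  with \<open>\<Phi> \<noteq> bot\<close> obtain R G where R: "R \<in> bidual smul" "G \<le> \<Phi>" "G \<noteq> bot"
    and lim: "\<And>f. f \<in> dual smul \<Longrightarrow> ((\<lambda>i. f (e i)) \<longlongrightarrow> R f) G"
    by (rule bidual_cluster_point) blast
  have "G \<le> net_filter I le"
    using R(2) by (simp add: \<Phi>_def)
  then have "((\<lambda>i. p a (e i)) \<longlongrightarrow> a) G" for a
    using e by (auto simp: is_right_bai_def intro: tendsto_mono)
  from arens_right_unit[OF lim R(3) this E(1)] have "R = E"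
    using E(2)[OF R(1)] by simp
  then have "eventually (\<lambda>i. f (e i) \<in> U) G"
    using lim[OF f] U(1,2) by (auto dest: topological_tendstoD)
  moreover have "eventually (\<lambda>i. f (e i) \<notin> U) G"
    by (rule filter_leD[OF R(2)]) (simp add: \<Phi>_def eventually_inf_principal)
  ultimately have "eventually (\<lambda>_. False) G"
    by eventually_elim simp
  with R(3) show False
    by (simp add: trivial_limit_def)
qed

text \<open>Weak-* convergence of \<open>e\<close> to \<open>E\<close>, tested at
  \<open>F.f\<close>, yields the limit \<open>(E.F) f = F f\<close>.\<close>

lemma unital_imp_wstar_bai:
  fixes e :: "'i \<Rightarrow> 'a"
  assumes e: "is_right_bai I le e" and "unital_on (bidual smul) arens"
  shows "is_wstar_bai I le e"
proof -
  obtain E where E: "E \<in> bidual smul" "\<And>F. F \<in> bidual smul \<Longrightarrow> arens E F = F"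
    using assms(2) unfolding unital_on_def by blast
  have "((\<lambda>i. F (\<lambda>b. f (p (e i) b))) \<longlongrightarrow> F f) (net_filter I le)"
    if F: "F \<in> bidual smul" and f: "f \<in> dual smul" for F f
    using right_bai_tendsto_unit[OF e E bidual_act_in_dual[OF F f]] fun_cong[OF E(2)[OF F], of f] f
    by (simp add: arens_def)
  with e show ?thesis
    by (simp add: is_wstar_bai_def is_right_bai_def)
qed

section \<open>Weak sequential completeness\<close>

text \<open>The sequence \<open>e\<close> converges weak-* to the unit, hence is weakly Cauchy and
  has a weak limit \<open>x\<close> in \<open>A\<close>. Testing this limit on the two translates of
  \<open>f\<close> by \<open>b\<close> and comparing with the norm limits of
  \<open>p (e n) b\<close> and \<open>p b (e n)\<close> gives both identities.\<close>

lemma weakly_complete_weak_unit: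
  fixes e :: "nat \<Rightarrow> 'a"
  assumes wsc: "weakly_sequentially_complete smul"
    and e: "is_right_bai UNIV (\<le>) e" and e': "\<And>a. (\<lambda>n. p (e n) a) \<longlonglongrightarrow> a"
    and unital: "unital_on (bidual smul) arens"
  obtains x where "\<And>f b. f \<in> dual smul \<Longrightarrow> f (p x b) = f b" "\<And>f b. f \<in> dual smul \<Longrightarrow> f (p b x) = f b"
proof -
  obtain E where E: "E \<in> bidual smul" "\<And>F. F \<in> bidual smul \<Longrightarrow> arens E F = F"
    using unital unfolding unital_on_def by blast
  have "(\<lambda>n. f (e n)) \<longlonglongrightarrow> E f" if "f \<in> dual smul" for f
    using right_bai_tendsto_unit[OF e E that] by (simp add: net_filter_nat)
  then have "weakly_Cauchy smul e"
    unfolding weakly_Cauchy_def using LIMSEQ_imp_Cauchy by blast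
  then obtain x where x: "\<And>f. f \<in> dual smul \<Longrightarrow> (\<lambda>n. f (e n)) \<longlonglongrightarrow> f x"
    using wsc unfolding weakly_sequentially_complete_def by blast
  have cont: "(\<lambda>n. f (X n)) \<longlonglongrightarrow> f b" if "f \<in> dual smul" "X \<longlonglongrightarrow> b" for f X b
    using that bounded_linear.tendsto by (force simp: dual_def)
  have e'': "(\<lambda>n. p a (e n)) \<longlonglongrightarrow> a" for a
    using e by (simp add: is_right_bai_def net_filter_nat)
  show thesis
  proof (rule that)
    fix f b assume f: "f \<in> dual smul"
    show "f (p x b) = f b"
      using x[OF dual_compose_right[OF f]] cont[OF f e'] by (rule LIMSEQ_unique)
    show "f (p b x) = f b"
      using x[OF dual_compose_left[OF f]] cont[OF f e''] by (rule LIMSEQ_unique)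
  qed
qed

text \<open>The translate of \<open>f\<close> by \<open>x\<close> is \<open>f\<close>, so the values
  to be tested are constantly \<open>F f\<close>.\<close>

lemma is_wstar_bai_const:
  assumes "\<And>f b. f \<in> dual smul \<Longrightarrow> f (p x b) = f b"
  shows "is_wstar_bai (UNIV :: nat set) (\<le>) (\<lambda>_. x)"
proof -
  have "(\<lambda>b. f (p x b)) = f" if "f \<in> dual smul" for f
    using assms[OF that] by simp
  then show ?thesis
    by (auto simp: is_wstar_bai_def bounded_net_def directed_set_def image_constant_conv
        intro: max.cobounded1 max.cobounded2)
qed

end

section \<open>Both multiplications together\<close>

theorem corollary2:
  fixes smul :: "'k::{real_normed_field, euclidean_space} \<Rightarrow> 'a::{real_normed_algebra, banach} \<Rightarrow> 'a"
  assumes "banach_algebra_over smul"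
    and "has_bai TYPE('a)"
  shows "(unital_on (bidual smul) (arens1 smul) \<longleftrightarrow> has_wstar_lbai smul) \<and>
    (unital_on (bidual smul) (arens2 smul) \<longleftrightarrow> has_wstar_rbai smul) \<and>
    (unital_on (bidual smul) (arens1 smul) \<and> unital_on (bidual smul) (arens2 smul)
      \<longleftrightarrow> has_wstar_bai smul) \<and>
    (weakly_sequentially_complete smul \<and> has_sequential_bai TYPE('a) \<longrightarrow>
      (has_wstar_lbai smul \<longleftrightarrow> has_wstar_rbai smul) \<and>
      (unital_on (bidual smul) (arens1 smul) \<longleftrightarrow> unital_on (bidual smul) (arens2 smul)))"
proof -
  interpret banach_algebra_over smul
    by fact
  interpret L: bilinear_product smul "(*)"
    by (intro bilinear_product.intro bilinear_product_axioms.intro)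
      (fact banach_algebra_over_axioms bounded_bilinear_mult mult_smul_left mult_smul_right)+
  interpret R: bilinear_product smul "\<lambda>x y. y * x"
    by (intro bilinear_product.intro bilinear_product_axioms.intro)
      (fact banach_algebra_over_axioms bounded_bilinear.flip[OF bounded_bilinear_mult]
        mult_smul_left mult_smul_right)+
  have arens1: "arens1 smul = L.arens"
    by (simp add: fun_eq_iff arens1_def L.arens_def bidual_act1_def dual_act1_def)
  have "arens2 smul = (\<lambda>F G. R.arens G F)"
    by (simp add: fun_eq_iff arens2_def R.arens_def bidual_act2_def dual_act2_def)
  then have arens2: "unital_on (bidual smul) (arens2 smul) \<longleftrightarrow> unital_on (bidual smul) R.arens"
    using unital_on_flip[of "bidual smul" R.arens] by simp
  have lbai: "is_wstar_lbai smul I le u \<longleftrightarrow> L.is_wstar_bai I le u"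
    for I le and u :: "'i \<Rightarrow> 'a"
    using L.bidual_act_in_dual
    by (auto simp: is_wstar_lbai_def L.is_wstar_bai_def arens1_def bidual_act1_def dual_act1_def
        canonical_embedding_def)
  \<comment> \<open>Although \<open>F.a\<close> is formed with the first product, it sends
    \<open>f\<close> to \<open>F (\<lambda>b. f (b * a))\<close>, which is the left action of
    \<open>a\<close> for the reversed multiplication.\<close>
  have rbai: "is_wstar_rbai smul I le u \<longleftrightarrow> R.is_wstar_bai I le u"
    for I le and u :: "'i \<Rightarrow> 'a"
    using L.dual_compose_left
    by (auto simp: is_wstar_rbai_def R.is_wstar_bai_def arens1_def bidual_act1_def dual_act1_def
        canonical_embedding_def)
  obtain I le and e :: "'a \<times> 'a set \<Rightarrow> 'a" where "is_bai I le e"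
    using assms(2) unfolding has_bai_def by blast
  then have e: "L.is_right_bai I le e" "R.is_right_bai I le e"
    by (simp_all add: is_bai_def L.is_right_bai_def R.is_right_bai_def)
  \<comment> \<open>From left to right the witness is the given approximate identity, whose index
    type is already the required one.\<close>
  have i: "unital_on (bidual smul) (arens1 smul) \<longleftrightarrow> has_wstar_lbai smul"
    unfolding arens1 has_wstar_lbai_def lbai
    using L.unital_imp_wstar_bai[OF e(1)] L.wstar_bai_imp_unital[OF e(1)] by blast
  have ii: "unital_on (bidual smul) (arens2 smul) \<longleftrightarrow> has_wstar_rbai smul"
    unfolding arens2 has_wstar_rbai_def rbai
    using R.unital_imp_wstar_bai[OF e(2)] R.wstar_bai_imp_unital[OF e(2)] by blast
  have iv: "has_wstar_lbai smul \<longleftrightarrow> has_wstar_rbai smul"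
    if wsc: "weakly_sequentially_complete smul" and sbai: "has_sequential_bai TYPE('a)"
  proof -
    obtain s :: "nat \<Rightarrow> 'a" where "is_bai UNIV (\<le>) s"
      using sbai unfolding has_sequential_bai_def by blast
    then have s: "L.is_right_bai UNIV (\<le>) s" "R.is_right_bai UNIV (\<le>) s"
      and lim: "(\<lambda>n. s n * a) \<longlonglongrightarrow> a" "(\<lambda>n. a * s n) \<longlonglongrightarrow> a" for a
      by (simp_all add: is_bai_def L.is_right_bai_def R.is_right_bai_def net_filter_nat)
    show ?thesis
    proof
      assume "has_wstar_lbai smul"
      then have "unital_on (bidual smul) L.arens"
        using i arens1 by simp
      then obtain x where "\<And>f b. f \<in> dual smul \<Longrightarrow> f (b * x) = f b"
        by (rule L.weakly_complete_weak_unit[OF wsc s(1) lim(1)]) blast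
      then have "is_wstar_rbai smul UNIV (\<le>) (\<lambda>_ :: nat. x)"
        unfolding rbai by (rule R.is_wstar_bai_const)
      then show "has_wstar_rbai smul"
        by (rule is_wstar_rbai_imp_has_wstar_rbai)
    next
      assume "has_wstar_rbai smul"
      then have "unital_on (bidual smul) R.arens"
        using ii arens2 by simp
      then obtain x where "\<And>f b. f \<in> dual smul \<Longrightarrow> f (x * b) = f b"
        by (rule R.weakly_complete_weak_unit[OF wsc s(2) lim(2)]) blast
      then have "is_wstar_lbai smul UNIV (\<le>) (\<lambda>_ :: nat. x)"
        unfolding lbai by (rule L.is_wstar_bai_const)
      then show "has_wstar_lbai smul"
        by (rule is_wstar_lbai_imp_has_wstar_lbai)
    qed
  qed
  \<comment> \<open>Through \<open>i\<close> and \<open>ii\<close>, the third claim becomes the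
    definition of a W*BAI and the last equivalence becomes \<open>iv\<close>.\<close>
  show ?thesis
    unfolding has_wstar_bai_def i ii using iv by blast
qed

end
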